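(* Let $N\ge3$, $R>0$, let $B_R\subset\mathbb{R}^N$ be the open ball of radius $R$ centered at the origin, and for $m\ne0$, $n\neq0$ let $$u_{m,n}(x)=|x|^{-\frac{N-2}{2}}\left(m^2+n^2\left(-\log\frac{|x|}{R}\right)^{-\frac2{N-2}}\right)^{-\frac{N-2}{2}},\qquad x\in B_R\setminus\{0\}.$$ Then each $u=u_{m,n}$ solves the Euler–Lagrange equation $$-\Delta u-\left(\frac{N-2}{2}\right)^2\frac{u}{|x|^2}=\left(-\log\frac{|x|}{R}\right)^{-\frac{2(N-1)}{N-2}}u^{\frac{N+2}{N-2}},\qquad u|_{\partial B_R}=0,$$ corresponding to the improved Hardy–Sobolev inequality recalled in the context.
   Context: The improved Hardy–Sobolev inequality in question is $$\int_{B_R}|\nabla u|^2\,dx\ \ge\ \left(\frac{N-2}{2}\right)^2\int_{B_R}\frac{u^2}{|x|^2}\,dx+C_{HS}\left(\int_{B_R}|u|^{\frac{2N}{N-2}}\left(-\log\frac{|x|}{R}\right)^{-\frac{2(N-1)}{N-2}}dx\right)^{\frac{N-2}{N}}$$ for radially symmetric $u\in C_0^\infty(B_R\setminus\{0\})$, where $C_{HS}>0$ is a constant. The functions $u_{m,n}$ are those given in the paper as the minimizers of this inequality.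
   Formalization: The right-hand side of the equation needs the factor N m²n²/(N−2): as displayed it fails, e.g. for N=4, m=n=1. The equation is proved with this factor for all m,n≠0, and the displayed equation is shown to hold exactly when the factor equals 1. *)

theory Defs
  imports "HOL-Analysis.Analysis"
begin

definition partial_deriv :: "'n \<Rightarrow> (real ^ 'n \<Rightarrow> real) \<Rightarrow> real ^ 'n \<Rightarrow> real"
  where "partial_deriv i f x = frechet_derivative f (at x) (axis i 1)"

definition laplacian :: "(real ^ 'n \<Rightarrow> real) \<Rightarrow> real ^ 'n \<Rightarrow> real"
  where "laplacian f x = (\<Sum>i\<in>UNIV. partial_deriv i (partial_deriv i f) x)"

text \<open>The class \<open>C\<^sup>2(S)\<close>; meant for open \<open>S\<close> only.\<close>

definition C2_on :: "(real ^ 'n) set \<Rightarrow> (real ^ 'n \<Rightarrow> real) \<Rightarrow> bool"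
  where "C2_on S f \<longleftrightarrow>
    f differentiable_on S \<and>
    (\<forall>i. partial_deriv i f differentiable_on S) \<and>
    (\<forall>i j. continuous_on S (partial_deriv j (partial_deriv i f)))"

text \<open>
  The formula is meant for \<open>0 < norm x < R\<close>. On the sphere \<open>norm x = R\<close> it does not return
  the continuous extension, which is \<open>0\<close>, because \<open>0 powr a = 0\<close> also for negative \<open>a\<close>.
\<close>

definition hs_minimizer :: "real \<Rightarrow> real \<Rightarrow> real \<Rightarrow> real \<Rightarrow> real ^ 'n \<Rightarrow> real"
  where "hs_minimizer N R m n x =
    norm x powr (- ((N - 2) / 2)) *
    (m\<^sup>2 + n\<^sup>2 * (- ln (norm x / R)) powr (- (2 / (N - 2)))) powr (- ((N - 2) / 2))"

text \<open>
  Positive classical solutions, on the ball of radius \<open>R\<close> punctured at the origin, of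
  \<open>- \<Delta>u - ((N - 2) / 2)\<^sup>2 u / |x|\<^sup>2 = \<mu> (- log (|x| / R))^(-2(N - 1) / (N - 2)) u^((N + 2) / (N - 2))\<close>
  with zero boundary values on the sphere of radius \<open>R\<close>. Here \<open>\<mu>\<close> is the Lagrange multiplier of
  the minimization problem for the improved Hardy-Sobolev inequality; \<open>\<mu> = 1\<close> is the normalized
  equation. Positivity makes \<open>powr\<close> the usual real power. The boundary condition is a limit from
  inside the ball, so the values of \<open>u\<close> on the sphere are irrelevant.
\<close>

definition solves_hs_euler_lagrange ::
    "real \<Rightarrow> real \<Rightarrow> real \<Rightarrow> (real ^ 'n \<Rightarrow> real) \<Rightarrow> bool"
  where "solves_hs_euler_lagrange N R \<mu> u \<longleftrightarrow>
    C2_on (ball 0 R - {0}) u \<and>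
    (\<forall>x \<in> ball 0 R - {0}. 0 < u x) \<and>
    (\<forall>x \<in> ball 0 R - {0}.
       - laplacian u x - ((N - 2) / 2)\<^sup>2 * (u x / (norm x)\<^sup>2) =
       \<mu> * ((- ln (norm x / R)) powr (- (2 * (N - 1) / (N - 2))) * u x powr ((N + 2) / (N - 2)))) \<and>
    (\<forall>z \<in> sphere 0 R. (u \<longlongrightarrow> 0) (at z within ball 0 R - {0}))"

end

theory Submission
  imports Defs
begin

text \<open>
  In the Emden--Fowler coordinates \<open>t = - log (|x| / R)\<close>, \<open>u = |x|^(-k) g t\<close> with
  \<open>k = (N - 2) / 2\<close>, the operator \<open>- \<Delta> - k\<^sup>2 / |x|\<^sup>2\<close> becomes \<open>- |x|^(-k - 2) g'' t\<close>, so that the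
  equation reduces to the ordinary differential equation
  \<open>- g'' = \<mu> t^(-(2 + 1/k)) g^((k + 2) / k)\<close>. The function \<open>g t = (m\<^sup>2 + n\<^sup>2 t^(-1/k))^(-k)\<close> solves it
  with \<open>\<mu> = (k + 1) / k m\<^sup>2 n\<^sup>2\<close>. Evaluating both sides at one point shows that the multiplier of a
  positive solution is unique.
\<close>

section \<open>Radial functions\<close>

text \<open>The chain rule gives the gradient F'(|x|) x / |x|. Writing F' as
  \<open>norm x * D\<close> cancels the quotient and leaves D x, a form to which differentiation can
  be applied again.\<close>

lemma has_derivative_radial:
  fixes F :: "real \<Rightarrow> real" and x :: "'a :: real_inner"
  assumes "(F has_real_derivative norm x * D) (at (norm x))" and "x \<noteq> 0"
  shows "((\<lambda>y. F (norm y)) has_derivative (\<lambda>h. D * (x \<bullet> h))) (at x)"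
proof -
  have "((\<lambda>y. F (norm y)) has_derivative (\<lambda>h. norm x * D * (sgn x \<bullet> h))) (at x)"
    using has_derivative_compose[OF has_derivative_norm[OF assms(2)]
        assms(1)[unfolded has_field_derivative_def]]
    by (simp add: inner_commute)
  moreover have "norm x * D * (sgn x \<bullet> h) = D * (x \<bullet> h)" for h
    using assms(2) by (simp add: sgn_div_norm)
  ultimately show ?thesis by simp
qed

lemma partial_deriv_eqI:
  "(f has_derivative D) (at x) \<Longrightarrow> partial_deriv i f x = D (axis i 1)"
  by (simp add: partial_deriv_def frechet_derivative_at[symmetric])

text \<open>With F' = r G and G' = r H the gradient is G x and the Hessian has entries G \<delta>_ij
  + H x_i x_j. Its trace is the stated Laplacian, and continuity of H carries over to every second
  partial derivative.\<close>

lemma radial_C2_laplacian: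
  fixes F G H :: "real \<Rightarrow> real" and u :: "real ^ 'n \<Rightarrow> real"
  assumes F: "\<And>r. \<lbrakk>0 < r; r < R\<rbrakk> \<Longrightarrow> (F has_real_derivative r * G r) (at r)"
    and G: "\<And>r. \<lbrakk>0 < r; r < R\<rbrakk> \<Longrightarrow> (G has_real_derivative r * H r) (at r)"
    and H: "continuous_on {0<..<R} H"
    and u: "\<And>x. u x = F (norm x)"
  shows "C2_on (ball 0 R - {0}) u"
    and "x \<in> ball 0 R - {0} \<Longrightarrow>
      laplacian u x = (norm x)\<^sup>2 * H (norm x) + real CARD('n) * G (norm x)"
proof -
  let ?S = "ball 0 R - {0 :: real ^ 'n}"
  have S: "open ?S" by (simp add: open_delete)
  have du: "(u has_derivative (\<lambda>h. G (norm x) * (x \<bullet> h))) (at x)" if "x \<in> ?S" for x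
    unfolding u[abs_def] using that by (intro has_derivative_radial F) auto
  have p1: "partial_deriv i u x = G (norm x) * x $ i" if "x \<in> ?S" for i x
    using partial_deriv_eqI[OF du[OF that]] by (simp add: inner_axis)
  have dG: "((\<lambda>y. G (norm y)) has_derivative (\<lambda>h. H (norm x) * (x \<bullet> h))) (at x)"
    if "x \<in> ?S" for x :: "real ^ 'n"
    using that by (intro has_derivative_radial G) auto
  have dp1: "(partial_deriv i u has_derivative
      (\<lambda>h. G (norm x) * h $ i + H (norm x) * (x \<bullet> h) * x $ i)) (at x)" if "x \<in> ?S" for i x
  proof -
    have "((\<lambda>y. G (norm y) * y $ i) has_derivative
        (\<lambda>h. G (norm x) * h $ i + H (norm x) * (x \<bullet> h) * x $ i)) (at x)"
      by (intro has_derivative_mult dG that bounded_linear_imp_has_derivative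
            bounded_linear_vec_nth)
    \<comment> \<open>The formula \<open>p1\<close> holds only on the punctured ball; openness of
      that set is what lets it be differentiated.\<close>
    then show ?thesis
      by (rule has_derivative_transform_within_open[OF _ S that]) (simp add: p1)
  qed
  have p2: "partial_deriv j (partial_deriv i u) x =
      G (norm x) * (if i = j then 1 else 0) + H (norm x) * x $ j * x $ i"
    if "x \<in> ?S" for i j x
    using partial_deriv_eqI[OF dp1[OF that]] by (simp add: inner_axis) (simp add: axis_def)
  have cG: "continuous_on {0<..<R} G"
    by (intro continuous_at_imp_continuous_on ballI DERIV_isCont[OF G]) auto
  have cn: "continuous_on ?S (\<lambda>x. K (norm x))" if "continuous_on {0<..<R} K"
    for K :: "real \<Rightarrow> real"
    by (rule continuous_on_compose2[OF that]) (auto intro!: continuous_intros)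
  show "C2_on ?S u"
    unfolding C2_on_def
  proof (intro conjI allI)
    show "u differentiable_on ?S"
      using du by (meson differentiableI differentiable_at_imp_differentiable_on)
    show "partial_deriv i u differentiable_on ?S" for i
      using dp1 by (meson differentiableI differentiable_at_imp_differentiable_on)
    show "continuous_on ?S (partial_deriv j (partial_deriv i u))" for i j
    proof (subst continuous_on_cong[OF refl p2])
      show "continuous_on ?S (\<lambda>x. G (norm x) * (if i = j then 1 else 0) + H (norm x) * x $ j * x $ i)"
        by (intro continuous_intros cn cG H)
    qed auto
  qed
  show "laplacian u x = (norm x)\<^sup>2 * H (norm x) + real CARD('n) * G (norm x)" if "x \<in> ?S"
  proof -
    have "laplacian u x = (\<Sum>i\<in>UNIV. G (norm x) + H (norm x) * (x $ i * x $ i))"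
      unfolding laplacian_def by (simp add: p2[OF that] mult.assoc)
    also have "\<dots> = real CARD('n) * G (norm x) + H (norm x) * (\<Sum>i\<in>UNIV. x $ i * x $ i)"
      by (simp add: sum.distrib sum_distrib_left)
    also have "(\<Sum>i\<in>UNIV. x $ i * x $ i) = (norm x)\<^sup>2"
      by (simp add: power2_norm_eq_inner inner_vec_def)
    finally show ?thesis by simp
  qed
qed

text \<open>Since dt/dr = -1/r, the Laplacian of u in dimension N is r^(-k-2) (g'' + (2k + 2 - N) g'
  + k (k + 2 - N) g). For N = 2k + 2 the g' term vanishes and the g term is -k^2 g, which the Hardy
  potential cancels.\<close>

lemma emden_fowler:
  fixes g g1 g2 :: "real \<Rightarrow> real" and k R :: real and u :: "real ^ 'n \<Rightarrow> real"
  assumes N: "real CARD('n) = 2 * k + 2" and R: "0 < R"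
    and g: "\<And>t. 0 < t \<Longrightarrow> (g has_real_derivative g1 t) (at t)"
    and g1: "\<And>t. 0 < t \<Longrightarrow> (g1 has_real_derivative g2 t) (at t)"
    and g2: "continuous_on {0<..} g2"
    and u: "\<And>x. u x = norm x powr (- k) * g (- ln (norm x / R))"
  shows "C2_on (ball 0 R - {0}) u"
    and "x \<in> ball 0 R - {0} \<Longrightarrow> - laplacian u x - k\<^sup>2 * (u x / (norm x)\<^sup>2) =
      - (norm x powr (- k - 2) * g2 (- ln (norm x / R)))"
proof -
  define T where "T r = - ln (r / R)" for r
  define F where "F r = r powr (- k) * g (T r)" for r
  \<comment> \<open>\<open>G\<close> and \<open>H\<close> are F'/r and G'/r, computed with T' =
    -1/r.\<close>
  define G where "G r = - (r powr (- k - 2) * (k * g (T r) + g1 (T r)))" for r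
  define H where "H r = r powr (- k - 4) *
    (g2 (T r) + (2 * k + 2) * g1 (T r) + k * (k + 2) * g (T r))" for r
  have T_pos: "0 < T r" if "0 < r" "r < R" for r
    using that by (simp add: T_def)
  have T': "(T has_real_derivative - (1 / r)) (at r)" if "0 < r" for r
    unfolding T_def using that R by (auto intro!: derivative_eq_intros simp: field_simps)
  \<comment> \<open>Used to write the powers of r in each identity as integer powers of r times one
    common lowest power, so that only ring algebra remains.\<close>
  have powr_shift: "r powr b = r * r powr a" if "0 < r" "b = a + 1" for r a b :: real
    using that by (simp add: powr_add)
  have gT: "((\<lambda>r. g (T r)) has_real_derivative g1 (T r) * - (1 / r)) (at r)"
    and g1T: "((\<lambda>r. g1 (T r)) has_real_derivative g2 (T r) * - (1 / r)) (at r)"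
    if "0 < r" "r < R" for r
    by (intro DERIV_chain2[OF _ T'] g g1 T_pos that)+
  have pw: "((\<lambda>r. r powr a) has_real_derivative a * r powr (a - 1)) (at r)"
    if "0 < r" for r a :: real
    using has_real_derivative_powr[OF that] .
  have F: "(F has_real_derivative r * G r) (at r)" if r: "0 < r" "r < R" for r
  proof -
    have "(F has_real_derivative
        - k * r powr (- k - 1) * g (T r) + g1 (T r) * - (1 / r) * r powr (- k)) (at r)"
      unfolding F_def by (intro DERIV_mult pw gT r)
    moreover have "r powr (- k - 1) = r * r powr (- k - 2)" "r powr (- k) = r * (r * r powr (- k - 2))"
      using powr_shift[OF r(1), of "- k - 1" "- k - 2"] powr_shift[OF r(1), of "- k" "- k - 1"]
      by simp_all
    ultimately show ?thesis
      using r by (simp add: G_def algebra_simps)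
  qed
  have G: "(G has_real_derivative r * H r) (at r)" if r: "0 < r" "r < R" for r
  proof -
    have "(G has_real_derivative
        - ((- k - 2) * r powr (- k - 2 - 1) * (k * g (T r) + g1 (T r)) +
          (k * (g1 (T r) * - (1 / r)) + g2 (T r) * - (1 / r)) * r powr (- k - 2))) (at r)"
      unfolding G_def by (intro DERIV_minus DERIV_mult DERIV_add DERIV_cmult pw gT g1T r)
    moreover have "r powr (- k - 2 - 1) = r * r powr (- k - 4)"
      "r powr (- k - 2) = r * (r * r powr (- k - 4))"
      using powr_shift[OF r(1), of "- k - 3" "- k - 4"] powr_shift[OF r(1), of "- k - 2" "- k - 3"]
      by (simp_all add: algebra_simps)
    ultimately show ?thesis
      using r by (simp add: H_def algebra_simps)
  qed
  have T_cont: "continuous_on {0<..<R} T"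
    unfolding T_def using R by (auto intro!: continuous_intros)
  have comp: "continuous_on {0<..<R} (\<lambda>r. K (T r))" if "continuous_on {0<..} K"
    for K :: "real \<Rightarrow> real"
    by (rule continuous_on_compose2[OF that T_cont]) (auto intro: T_pos)
  have "continuous_on {0<..} g" "continuous_on {0<..} g1"
    by (auto intro!: continuous_at_imp_continuous_on DERIV_isCont g g1)
  then have H: "continuous_on {0<..<R} H"
    unfolding H_def by (intro continuous_intros comp g2) auto
  have uF: "u x = F (norm x)" for x
    by (simp add: u F_def T_def)
  note rad = radial_C2_laplacian[of R F G H u, OF F G H uF]
  show "C2_on (ball 0 R - {0}) u"
    by (rule rad(1))
  show "- laplacian u x - k\<^sup>2 * (u x / (norm x)\<^sup>2) = - (norm x powr (- k - 2) * g2 (- ln (norm x / R)))"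
    if x: "x \<in> ball 0 R - {0}"
  proof -
    define r where "r = norm x"
    have r: "0 < r" using x by (simp add: r_def)
    have "r\<^sup>2 * r powr (- k - 4) = r powr (- k - 2)"
      using powr_shift[OF r, of "- k - 3" "- k - 4"] powr_shift[OF r, of "- k - 2" "- k - 3"]
      by (simp add: power2_eq_square)
    then have 1: "r\<^sup>2 * H r = r powr (- k - 2) *
        (g2 (T r) + (2 * k + 2) * g1 (T r) + k * (k + 2) * g (T r))"
      by (simp add: H_def flip: mult.assoc)
    have "r\<^sup>2 * r powr (- k - 2) = r powr (- k)"
      using powr_shift[OF r, of "- k - 1" "- k - 2"] powr_shift[OF r, of "- k" "- k - 1"]
      by (simp add: power2_eq_square)
    then have 2: "u x / r\<^sup>2 = r powr (- k - 2) * g (T r)"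
      using r by (simp add: uF F_def r_def field_simps)
    have "laplacian u x = r\<^sup>2 * H r + real CARD('n) * G r"
      unfolding r_def by (rule rad(2)[OF _ _ _ _ x])
    then show ?thesis
      using 1 2 unfolding N r_def[symmetric] T_def[symmetric]
      by (simp add: G_def algebra_simps power2_eq_square)
  qed
qed

section \<open>The radial profile\<close>

context
  fixes k m n :: real
  assumes k: "0 < k" and m: "m \<noteq> 0"
begin

definition profile_base :: "real \<Rightarrow> real"
  where "profile_base t = m\<^sup>2 + n\<^sup>2 * t powr (- (1 / k))"

lemma profile_base_pos: "0 < profile_base t"
  unfolding profile_base_def using m by (simp add: add_pos_nonneg)

lemma profile_base_deriv:
  assumes "0 < t"
  shows "(profile_base has_real_derivative - (n\<^sup>2 / k * t powr (- (1 / k) - 1))) (at t)"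
  unfolding profile_base_def
  by (rule derivative_eq_intros has_real_derivative_powr refl assms)+ simp

lemma profile_base_powr_deriv:
  assumes "0 < t"
  shows "((\<lambda>t. profile_base t powr a) has_real_derivative
    - (a * profile_base t powr (a - 1) * (n\<^sup>2 / k * t powr (- (1 / k) - 1)))) (at t)"
  using DERIV_chain2[OF has_real_derivative_powr[OF profile_base_pos] profile_base_deriv[OF assms]]
  by simp

lemma profile_deriv:
  assumes "0 < t"
  shows "((\<lambda>t. profile_base t powr (- k)) has_real_derivative
    n\<^sup>2 * (profile_base t powr (- k - 1) * t powr (- (1 / k) - 1))) (at t)"
  using profile_base_powr_deriv[OF assms, of "- k"] k by (simp add: mult_ac)

text \<open>Put c = (k + 1)/k, b = t^(-1/k), s = t^(-(2 + 1/k)), and let A be the base to the power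
  -k - 2. The product rule gives c n^4 b s A from the base and -c n^2 s (m^2 + n^2 b) A from the
  power of t; the n^4 terms cancel.\<close>

lemma profile_deriv2:
  assumes t: "0 < t"
  shows "((\<lambda>t. n\<^sup>2 * (profile_base t powr (- k - 1) * t powr (- (1 / k) - 1))) has_real_derivative
    - ((k + 1) / k * m\<^sup>2 * n\<^sup>2 * (t powr (- (2 + 1 / k)) * profile_base t powr (- k - 2)))) (at t)"
proof -
  let ?A = "profile_base t powr (- k - 2)" and ?s = "t powr (- (2 + 1 / k))"
  let ?b = "t powr (- (1 / k))"
  have "((\<lambda>t. n\<^sup>2 * (profile_base t powr (- k - 1) * t powr (- (1 / k) - 1))) has_real_derivative
      n\<^sup>2 * (- ((- k - 1) * profile_base t powr (- k - 1 - 1) * (n\<^sup>2 / k * t powr (- (1 / k) - 1)))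
        * t powr (- (1 / k) - 1) +
      (- (1 / k) - 1) * t powr (- (1 / k) - 1 - 1) * profile_base t powr (- k - 1))) (at t)"
    by (intro DERIV_cmult DERIV_mult profile_base_powr_deriv has_real_derivative_powr t)
  moreover have "profile_base t powr (- k - 1) = (m\<^sup>2 + n\<^sup>2 * ?b) * ?A"
    using powr_add[of "profile_base t" 1 "- k - 2"] profile_base_pos[of t]
    by (simp add: profile_base_def del: minus_diff_commute minus_add_distrib add_uminus_conv_diff)
  moreover have "t powr (- (1 / k) - 1) * t powr (- (1 / k) - 1) = ?b * ?s"
    by (simp flip: powr_add)
  moreover have "- k - 1 - 1 = - k - 2" "- (1 / k) - 1 - 1 = - (2 + 1 / k)"
    by simp_all
  \<comment> \<open>All powers are replaced by free variables, with p for t^(-1/k - 1). The only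
    relation between them that matters is p^2 = b s.\<close>
  moreover have "n\<^sup>2 * (- ((- k - 1) * A * (n\<^sup>2 / k * p)) * p + (- (1 / k) - 1) * s * ((m\<^sup>2 + n\<^sup>2 * b) * A))
      = - ((k + 1) / k * m\<^sup>2 * n\<^sup>2 * (s * A))" if "p * p = b * s" for A p s b
  proof -
    define c where "c = (k + 1) / k"
    have "n\<^sup>2 * (- ((- k - 1) * A * (n\<^sup>2 / k * p)) * p) = c * n\<^sup>2 * n\<^sup>2 * A * (p * p)"
      using k by (simp add: c_def field_simps)
    moreover have "- (1 / k) - 1 = - c"
      using k by (simp add: c_def field_simps)
    ultimately show ?thesis
      unfolding that distrib_left[of "n\<^sup>2"] c_def[symmetric] by (simp add: algebra_simps)
  qed
  ultimately show ?thesis by simp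
qed

text \<open>As t decreases to 0, the term n^2 t^(-1/k) blows up because n is nonzero, and the outer
  exponent -k is negative. The limit must be one-sided: at t = 0 the convention
  \<open>0 powr a = 0\<close> gives the base the value m^2.\<close>

lemma profile_tendsto_0:
  assumes "n \<noteq> 0"
  shows "((\<lambda>t. profile_base t powr (- k)) \<longlongrightarrow> 0) (at_right 0)"
proof (rule tendsto_neg_powr)
  have "filterlim (\<lambda>t :: real. t powr (- (1 / k))) at_top (at_right 0)"
    using k by real_asymp
  then have "filterlim (\<lambda>t. n\<^sup>2 * t powr (- (1 / k))) at_top (at_right 0)"
    using assms by (intro filterlim_tendsto_pos_mult_at_top[OF tendsto_const]) auto
  then show "filterlim profile_base at_top (at_right 0)"
    unfolding profile_base_def by (rule filterlim_tendsto_add_at_top[OF tendsto_const])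
qed (use k in simp)

end

text \<open>Inside the ball the norm is below R, so t tends to 0 through positive values. This turns
  the boundary condition into the one-sided limit of the profile.\<close>

lemma minus_ln_norm_at_sphere:
  fixes z :: "'a :: real_normed_vector"
  assumes "0 < R" and "norm z = R"
  shows "filterlim (\<lambda>x. - ln (norm x / R)) (at_right 0) (at z within ball 0 R - {0})"
proof (rule tendsto_imp_filterlim_at_right)
  have "((\<lambda>x. - ln (norm x / R)) \<longlongrightarrow> - ln (norm z / R)) (at z within ball 0 R - {0})"
    using assms by (intro tendsto_intros) auto
  then show "((\<lambda>x. - ln (norm x / R)) \<longlongrightarrow> 0) (at z within ball 0 R - {0})"
    using assms by simp
  show "\<forall>\<^sub>F x in at z within ball 0 R - {0}. 0 < - ln (norm x / R)"
    unfolding eventually_at_filter using assms by (intro always_eventually) auto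
qed

section \<open>The Euler-Lagrange equation and its multiplier\<close>

lemma hs_minimizer_solves:
  fixes N R m n :: real
  assumes N: "N = real CARD('n)" "N > 2" and R: "R > 0" and m: "m \<noteq> 0" and n: "n \<noteq> 0"
  shows "solves_hs_euler_lagrange N R (N / (N - 2) * m\<^sup>2 * n\<^sup>2)
    (hs_minimizer N R m n :: real ^ 'n \<Rightarrow> real)"
proof -
  define k where "k = (N - 2) / 2"
  have k: "0 < k" using N by (simp add: k_def)
  have Nk: "N = 2 * k + 2" by (simp add: k_def field_simps)
  note base_pos = profile_base_pos[OF k m, of n]
  let ?g = "\<lambda>t. profile_base k m n t powr (- k)"
  let ?g2 = "\<lambda>t. - ((k + 1) / k * m\<^sup>2 * n\<^sup>2 *
    (t powr (- (2 + 1 / k)) * profile_base k m n t powr (- k - 2)))"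
  let ?u = "hs_minimizer N R m n :: real ^ 'n \<Rightarrow> real"
  have "2 / (N - 2) = 1 / k"
    by (simp add: Nk)
  then have u: "?u x = norm x powr (- k) * ?g (- ln (norm x / R))" for x
    by (simp add: hs_minimizer_def profile_base_def[OF k m] flip: k_def)
  have "continuous_on {0<..} (profile_base k m n)"
    by (auto intro!: continuous_at_imp_continuous_on DERIV_isCont profile_base_deriv[OF k m])
  then have g2: "continuous_on {0<..} ?g2"
    using base_pos by (intro continuous_intros) (auto simp: less_imp_neq[symmetric])
  note ef = emden_fowler[of k R ?g, OF _ R profile_deriv[OF k m] profile_deriv2[OF k m] g2 u]
  show ?thesis
    unfolding solves_hs_euler_lagrange_def
  proof (intro conjI ballI)
    show "C2_on (ball 0 R - {0}) ?u"
      using N Nk by (intro ef(1)) auto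
    show "0 < ?u x" if "x \<in> ball 0 R - {0}" for x
      using that base_pos by (simp add: u less_imp_neq[symmetric])
    show "- laplacian ?u x - ((N - 2) / 2)\<^sup>2 * (?u x / (norm x)\<^sup>2) = N / (N - 2) * m\<^sup>2 * n\<^sup>2 *
        ((- ln (norm x / R)) powr (- (2 * (N - 1) / (N - 2))) * ?u x powr ((N + 2) / (N - 2)))"
      if x: "x \<in> ball 0 R - {0}" for x
    proof -
      have exps: "N / (N - 2) = (k + 1) / k" "2 * (N - 1) / (N - 2) = 2 + 1 / k"
        "(N + 2) / (N - 2) = (k + 2) / k" "- k * ((k + 2) / k) = - k - 2"
        using k by (simp_all add: Nk field_simps)
      \<comment> \<open>Raising to (k + 2)/k sends both exponents -k to -k - 2. These are exactly
        the powers of |x| and of the base produced by the operator on the left.\<close>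
      have "?u x powr ((N + 2) / (N - 2)) =
          norm x powr (- k - 2) * profile_base k m n (- ln (norm x / R)) powr (- k - 2)"
        unfolding u exps(3) by (simp add: powr_mult powr_powr exps(4)[simplified])
      moreover have "- laplacian ?u x - k\<^sup>2 * (?u x / (norm x)\<^sup>2) =
          - (norm x powr (- k - 2) * ?g2 (- ln (norm x / R)))"
        using N Nk by (intro ef(2) x) auto
      ultimately show ?thesis
        unfolding k_def[symmetric] exps(1,2) by (simp add: mult_ac)
    qed
    show "(?u \<longlongrightarrow> 0) (at z within ball 0 R - {0})" if "z \<in> sphere 0 R" for z
    proof -
      have z: "norm z = R" using that by simp
      have "((\<lambda>x. ?g (- ln (norm x / R))) \<longlongrightarrow> 0) (at z within ball 0 R - {0})"
        by (rule filterlim_compose[OF profile_tendsto_0[OF k m n] minus_ln_norm_at_sphere[OF R z]])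
      moreover have "((\<lambda>x. norm x powr (- k)) \<longlongrightarrow> norm z powr (- k)) (at z within ball 0 R - {0})"
        using R z by (intro tendsto_intros) auto
      \<comment> \<open>The factor |x|^(-k) has the finite limit R^(-k), so the product tends to
        0.\<close>
      ultimately show ?thesis
        using tendsto_mult by (fastforce simp: u[abs_def])
    qed
  qed
qed

lemma hs_multiplier_unique:
  fixes u :: "real ^ 'n \<Rightarrow> real"
  assumes R: "R > 0" and sol: "solves_hs_euler_lagrange N R \<mu> u" "solves_hs_euler_lagrange N R \<nu> u"
  shows "\<mu> = \<nu>"
proof -
  \<comment> \<open>Any coordinate direction serves. At radius R/2 the logarithmic factor is ln 2 >
    0, and u is positive there, so the common weight \<open>?w\<close> is nonzero and can be
    cancelled.\<close>
  obtain i :: 'n where True by simp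
  define x :: "real ^ 'n" where "x = (R / 2) *\<^sub>R axis i 1"
  have nx: "norm x = R / 2"
    using R by (simp add: x_def)
  then have x: "x \<in> ball 0 R - {0}"
    using R by auto
  let ?w = "(- ln (norm x / R)) powr (- (2 * (N - 1) / (N - 2))) * u x powr ((N + 2) / (N - 2))"
  have "\<mu> * ?w = \<nu> * ?w" "0 < u x"
    using sol x unfolding solves_hs_euler_lagrange_def by metis+
  moreover have "0 < - ln (norm x / R)"
    using R by (simp add: nx)
  ultimately show ?thesis by simp
qed

text \<open>Scaling (m, n) by s multiplies u by |s|^(-(N-2)) and the multiplier by s^4, so one fixed
  multiplier cannot fit the whole family. The coefficient 1 occurs exactly on the curve m^2 n^2 = (N
  - 2)/N, by uniqueness of the multiplier.\<close>

theorem theorem1p3: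
  fixes N R m n :: real and u :: "real ^ 'n \<Rightarrow> real"
  assumes "N = real CARD('n)" and "N \<ge> 3" and "R > 0" and "m \<noteq> 0" and "n \<noteq> 0"
    and "u = hs_minimizer N R m n"
  shows "solves_hs_euler_lagrange N R (N / (N - 2) * m\<^sup>2 * n\<^sup>2) u \<and>
    (solves_hs_euler_lagrange N R 1 u \<longleftrightarrow> N / (N - 2) * m\<^sup>2 * n\<^sup>2 = 1)"
proof -
  have "solves_hs_euler_lagrange N R (N / (N - 2) * m\<^sup>2 * n\<^sup>2) u"
    unfolding assms(6) using assms(2) by (intro hs_minimizer_solves assms) auto
  then show ?thesis
    using hs_multiplier_unique[OF assms(3)] by metis
qed

end
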